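(* Let $\xi,\xi_1,\xi_2,\ldots$ be independent identically distributed random variables taking values in $\{0,1,2,\ldots\}$ with $\mathbf{P}(\xi=i)=p_i>0$ for all $i\ge 0$, $\sum_{i\ge 0}p_i=1$. Let $\bar\xi_n$, $r(n)$, $a_n$ be as defined in the context, and let $l\ge 0$ be a fixed integer. Suppose that $r(n)$ is a monotonic function and $r(n)\to\infty$ as $n\to\infty$. Then: (i) for $l\in\{0,1\}$, $$\mathbf{P}(\bar\xi_n=a_n+l\ \text{ i.o.})=1;$$ (ii) for $l>1$, the probability $$\mathbf{P}(\bar\xi_n=a_n+l\ \text{ i.o.})$$ is equal to zero if the series $\sum_{k\ge 1}\exp(-(l-1)\,r(k))$ converges, and is equal to one if this series diverges.
   Context: For the i.i.d. sequence $\xi,\xi_1,\xi_2,\ldots$ set $\bar\xi_n=\max_{1\le i\le n}\xi_i$. For the distribution $(i,p_i)$, $i\ge0$, of $\xi$ define $$R(n)=-\ln\mathbf{P}(\xi\ge n)=-\ln\Big(\sum_{i\ge n}p_i\Big),\quad n\ge 0,\qquad r(n)=R(n)-R(n-1),\quad n\ge 1,$$ $$a_n=\max\Big(k\ge 0:\ \sum_{i\ge k}p_i\ge \frac1n\Big).$$ "i.o." means "infinitely often", i.e. the event occurs for infinitely many $n$. *)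

theory Defs
  imports "HOL-Probability.Probability"
begin

definition tail_prob :: "(nat \<Rightarrow> real) \<Rightarrow> nat \<Rightarrow> real" where
  "tail_prob p n = (\<Sum>i. p (n + i))"

definition cum_hazard :: "(nat \<Rightarrow> real) \<Rightarrow> nat \<Rightarrow> real" where
  "cum_hazard p n = - ln (tail_prob p n)"

text \<open>Only meaningful for \<open>n \<ge> 1\<close>; truncated subtraction makes the value at \<open>0\<close> equal to \<open>0\<close>.\<close>
definition hazard :: "(nat \<Rightarrow> real) \<Rightarrow> nat \<Rightarrow> real" where
  "hazard p n = cum_hazard p n - cum_hazard p (n - 1)"

text \<open>If \<open>p\<close> is a probability mass function, the set below is finite and contains \<open>0\<close>
  for every \<open>n \<ge> 1\<close>. The value at \<open>n = 0\<close> has no meaning, nor has that of the running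
  maximum below.\<close>
definition max_level :: "(nat \<Rightarrow> real) \<Rightarrow> nat \<Rightarrow> nat" where
  "max_level p n = Max {k. tail_prob p k \<ge> 1 / real n}"

definition running_max :: "(nat \<Rightarrow> 'a \<Rightarrow> nat) \<Rightarrow> nat \<Rightarrow> 'a \<Rightarrow> nat" where
  "running_max X n \<omega> = Max ((\<lambda>i. X i \<omega>) ` {1..n})"

end

theory Submission
  imports Defs
begin

text \<open>Write \<open>T k = P(\<xi> \<ge> k)\<close> and \<open>N k = \<lceil>1 / T k\<rceil>\<close>, so that \<open>a\<^sub>n = k\<close> exactly for \<open>n\<close> in the
  block \<open>N k \<le> n < N (k + 1)\<close>. If the maximum equals \<open>k + l\<close> somewhere in this block, one of
  fewer than \<open>1 / T (k + 1)\<close> variables is at least \<open>k + l\<close>, which has probability at most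
  \<open>T (k + l) / T (k + 1) \<le> exp (- (l - 1) r (k + 2))\<close>; the first Borel--Cantelli lemma settles the
  convergent case. Otherwise consider the independent events that the maximum over the \<open>k\<close>-th block
  alone is \<open>k + l\<close>. Their probabilities are at least a constant times
  \<open>min 1 (T (k + l) / T (k + 1))\<close>, hence not summable. The variables before the block stay below
  \<open>k + l + 1\<close> with probability tending to one, independently of that block and all later ones, so the
  Feller--Chung lemma carries the divergence over to the running maximum.\<close>

subsection \<open>Independence and the Feller--Chung lemma\<close>

lemma ball_restrict_less: "(\<forall>i\<in>A. restrict f A i < c) \<longleftrightarrow> (\<forall>i\<in>A. f i < c)"
  by simp

text \<open>On a finite index set the product of the discrete sigma-algebras of a countable type is
  again discrete, so every predicate of finitely many variables defines an event.\<close>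

lemma (in prob_space) restrict_event:
  fixes X :: "'i \<Rightarrow> 'a \<Rightarrow> 'b::countable"
  assumes ind: "indep_vars (\<lambda>_. count_space UNIV) X I" and A: "finite A" "A \<subseteq> I"
  shows "{\<omega> \<in> space M. P (restrict (\<lambda>i. X i \<omega>) A)} \<in> events"
proof -
  \<comment> \<open>Only measurability is wanted here; it is read off from the independence of the
    block \<open>A\<close> and the empty block.\<close>
  have "(\<lambda>\<omega>. restrict (\<lambda>i. X i \<omega>) A) \<in> measurable M (count_space (PiE A (\<lambda>_. UNIV)))"
    using indep_var_rv1[OF indep_var_restrict[OF ind, of A "{}"]] A by (simp add: count_space_PiM_finite)
  from measurable_sets[OF this, of "Collect P \<inter> PiE A (\<lambda>_. UNIV)"]
  have "(\<lambda>\<omega>. restrict (\<lambda>i. X i \<omega>) A) -` (Collect P \<inter> PiE A (\<lambda>_. UNIV)) \<inter> space M \<in> events"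
    by simp
  also have "(\<lambda>\<omega>. restrict (\<lambda>i. X i \<omega>) A) -` (Collect P \<inter> PiE A (\<lambda>_. UNIV)) \<inter> space M =
      {\<omega> \<in> space M. P (restrict (\<lambda>i. X i \<omega>) A)}"
    by auto
  finally show ?thesis .
qed

text \<open>Subfamilies over disjoint index sets are independent. Applying the predicates to
  restricted families expresses that each depends on its own block only.\<close>

lemma (in prob_space) prob_conj_restrict:
  fixes X :: "'i \<Rightarrow> 'a \<Rightarrow> 'b::countable"
  assumes ind: "indep_vars (\<lambda>_. count_space UNIV) X I"
    and AB: "finite A" "finite B" "A \<subseteq> I" "B \<subseteq> I" "A \<inter> B = {}"
  shows "prob {\<omega> \<in> space M. P (restrict (\<lambda>i. X i \<omega>) A) \<and> Q (restrict (\<lambda>i. X i \<omega>) B)} =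
    prob {\<omega> \<in> space M. P (restrict (\<lambda>i. X i \<omega>) A)} * prob {\<omega> \<in> space M. Q (restrict (\<lambda>i. X i \<omega>) B)}"
proof -
  let ?XA = "\<lambda>\<omega>. restrict (\<lambda>i. X i \<omega>) A" and ?XB = "\<lambda>\<omega>. restrict (\<lambda>i. X i \<omega>) B"
  have "indep_var (count_space (PiE A (\<lambda>_. UNIV))) ?XA (count_space (PiE B (\<lambda>_. UNIV))) ?XB"
    using indep_var_restrict[OF ind AB(5,3,4)] AB(1,2) by (simp add: count_space_PiM_finite)
  from indep_varD[OF this, of "Collect P \<inter> PiE A (\<lambda>_. UNIV)" "Collect Q \<inter> PiE B (\<lambda>_. UNIV)"]
  have "prob ((\<lambda>\<omega>. (?XA \<omega>, ?XB \<omega>)) -`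
        ((Collect P \<inter> PiE A (\<lambda>_. UNIV)) \<times> (Collect Q \<inter> PiE B (\<lambda>_. UNIV))) \<inter> space M) =
      prob (?XA -` (Collect P \<inter> PiE A (\<lambda>_. UNIV)) \<inter> space M) *
      prob (?XB -` (Collect Q \<inter> PiE B (\<lambda>_. UNIV)) \<inter> space M)"
    by simp
  moreover have "(\<lambda>\<omega>. (?XA \<omega>, ?XB \<omega>)) -`
        ((Collect P \<inter> PiE A (\<lambda>_. UNIV)) \<times> (Collect Q \<inter> PiE B (\<lambda>_. UNIV))) \<inter> space M =
      {\<omega> \<in> space M. P (?XA \<omega>) \<and> Q (?XB \<omega>)}"
    "?XA -` (Collect P \<inter> PiE A (\<lambda>_. UNIV)) \<inter> space M = {\<omega> \<in> space M. P (?XA \<omega>)}"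
    "?XB -` (Collect Q \<inter> PiE B (\<lambda>_. UNIV)) \<inter> space M = {\<omega> \<in> space M. Q (?XB \<omega>)}"
    by auto
  ultimately show ?thesis by simp
qed

text \<open>The Feller--Chung lemma: decompose the union of the \<open>B k\<close> according to the last index
  at which \<open>B k\<close> occurs.\<close>

lemma (in prob_space) feller_chung:
  fixes B G :: "nat \<Rightarrow> 'a set"
  assumes B: "\<And>k. B k \<in> events" and G: "\<And>k. G k \<in> events"
    and ind: "\<And>k. k \<in> {m..<K} \<Longrightarrow>
      prob (G k \<inter> (B k - (\<Union>j\<in>{k<..<K}. B j))) = prob (G k) * prob (B k - (\<Union>j\<in>{k<..<K}. B j))"
    and c: "\<And>k. k \<in> {m..<K} \<Longrightarrow> c \<le> prob (G k)"
  shows "c * prob (\<Union>k\<in>{m..<K}. B k) \<le> prob (\<Union>k\<in>{m..<K}. G k \<inter> B k)"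
proof -
  define E where "E k = B k - (\<Union>j\<in>{k<..<K}. B j)" for k
  have E: "E k \<in> events" for k unfolding E_def using B by auto
  have disj: "disjoint_family_on E {m..<K}"
    unfolding disjoint_family_on_def
  proof (intro ballI impI)
    fix i j assume "i \<in> {m..<K}" "j \<in> {m..<K}" "i \<noteq> j"
    then show "E i \<inter> E j = {}"
      by (cases i j rule: linorder_cases) (auto simp: E_def)
  qed
  have "\<exists>k\<in>{m..<K}. x \<in> E k" if "k \<in> {m..<K}" "x \<in> B k" for x k
  proof -
    define S where "S = {k\<in>{m..<K}. x \<in> B k}"
    have "finite S" "S \<noteq> {}" using that by (auto simp: S_def)
    then have a: "Max S \<in> S" by (rule Max_in)
    have ge: "j \<le> Max S" if "j \<in> S" for j using \<open>finite S\<close> that by (rule Max_ge)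
    have "x \<notin> B j" if j: "j \<in> {Max S<..<K}" for j
    proof
      assume "x \<in> B j"
      moreover have "m \<le> j" using a j by (auto simp: S_def)
      ultimately have "j \<in> S" using j by (simp add: S_def)
      then show False using ge j by fastforce
    qed
    moreover have "\<And>j. j \<in> S \<Longrightarrow> j \<in> {m..<K} \<and> x \<in> B j" by (simp add: S_def)
    ultimately show ?thesis using a unfolding E_def by blast
  qed
  then have "(\<Union>k\<in>{m..<K}. B k) = (\<Union>k\<in>{m..<K}. E k)"
    unfolding E_def by blast
  moreover have "prob (\<Union>k\<in>{m..<K}. E k) = (\<Sum>k\<in>{m..<K}. prob (E k))"
    using disj E by (intro finite_measure_finite_Union) auto
  ultimately have "c * prob (\<Union>k\<in>{m..<K}. B k) = (\<Sum>k\<in>{m..<K}. c * prob (E k))"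
    by (simp add: sum_distrib_left)
  \<comment> \<open>By independence, intersecting with \<open>G k\<close> keeps at least the
    fraction \<open>c\<close> of each disjoint piece.\<close>
  also have "\<dots> \<le> (\<Sum>k\<in>{m..<K}. prob (G k \<inter> E k))"
    by (intro sum_mono) (simp add: ind[folded E_def] c mult_right_mono)
  also have "\<dots> = prob (\<Union>k\<in>{m..<K}. G k \<inter> E k)"
    using disj E G by (intro finite_measure_finite_Union[symmetric]) (auto simp: disjoint_family_on_def)
  also have "\<dots> \<le> prob (\<Union>k\<in>{m..<K}. G k \<inter> B k)"
    using B G by (intro finite_measure_mono) (auto simp: E_def)
  finally show ?thesis .
qed

subsection \<open>Real inequalities\<close>

text \<open>A nonincreasing sequence stays below its value at 1. This rules out the decreasing
  alternative for the hazard.\<close>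

lemma not_antimono_on_tendsto_at_top:
  fixes f :: "nat \<Rightarrow> real"
  assumes "antimono_on {1..} f" "filterlim f at_top sequentially"
  shows False
proof -
  have "eventually (\<lambda>n. f 1 + 1 \<le> f n) sequentially"
    using assms(2) by (simp add: filterlim_at_top)
  then have "eventually (\<lambda>n. f 1 + 1 \<le> f n \<and> 1 \<le> n) sequentially"
    using eventually_ge_at_top by (rule eventually_conj)
  then obtain n where "f 1 + 1 \<le> f n" "1 \<le> n" by (auto simp: eventually_sequentially)
  then show False using assms(1) by (force simp: monotone_on_def)
qed

text \<open>Since \<open>1 - q k \<le> exp (- q k)\<close>, products bounded below by
  \<open>e\<close> would bound the partial sums of \<open>q\<close> by \<open>- ln e\<close>. This
  is the analytic core of the second Borel-Cantelli lemma.\<close>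

lemma prod_one_minus_small:
  fixes q :: "nat \<Rightarrow> real"
  assumes q: "\<And>k. 0 \<le> q k" "\<And>k. q k \<le> 1" and ns: "\<not> summable q" and e: "0 < e"
  obtains K where "(\<Prod>k\<in>{m..<K}. 1 - q k) < e"
proof (rule ccontr)
  assume "\<not> thesis"
  then have ge: "e \<le> (\<Prod>k\<in>{m..<K}. 1 - q k)" for K
    using that by (meson not_le)
  have "(\<Sum>k<n. q (k + m)) \<le> - ln e" for n
  proof -
    have "e \<le> (\<Prod>k\<in>{m..<m+n}. 1 - q k)" by (rule ge)
    also have "\<dots> \<le> (\<Prod>k\<in>{m..<m+n}. exp (- q k))"
      using q exp_ge_add_one_self[of "- q _"] by (intro prod_mono) auto
    also have "\<dots> = exp (- (\<Sum>k\<in>{m..<m+n}. q k))"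
      by (simp add: exp_sum sum_negf[symmetric])
    finally have "ln e \<le> ln (exp (- (\<Sum>k\<in>{m..<m+n}. q k)))"
      using e by (subst ln_le_cancel_iff) auto
    moreover have "(\<Sum>k\<in>{m..<m+n}. q k) = (\<Sum>k<n. q (k + m))"
      using sum.shift_bounds_nat_ivl[of q 0 m n] by (simp add: lessThan_atLeast0 add.commute)
    ultimately show ?thesis by simp
  qed
  then have "summable (\<lambda>k. q (k + m))" using q by (intro summableI_nonneg_bounded)
  then show False using ns by simp
qed

text \<open>For \<open>u \<le> 1/2\<close> the logarithm of \<open>1 - u\<close> is at least
  \<open>- u - 2 * u^2\<close>, hence at least \<open>- 2 * u\<close>; then
  \<open>n * u \<le> 1\<close> is used.\<close>

lemma exp_le_one_minus_power:
  fixes u :: real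
  assumes "0 \<le> u" "u \<le> 1/2" "real n * u \<le> 1"
  shows "exp (-2) \<le> (1 - u) ^ n"
proof -
  have "- 2 * u \<le> - u - 2 * u\<^sup>2"
    using mult_left_mono[of u "1/2" u] assms by (simp add: power2_eq_square)
  also have "\<dots> \<le> ln (1 - u)"
    by (rule ln_one_minus_pos_lower_bound) (use assms in auto)
  finally have "exp (- 2 * u) \<le> exp (ln (1 - u))" by simp
  then have "exp (- 2 * u) \<le> 1 - u" using assms by simp
  then have "exp (- 2 * u) ^ n \<le> (1 - u) ^ n" by (rule power_mono) simp
  moreover have "exp (-2) \<le> exp (- 2 * u) ^ n"
    using assms by (simp add: exp_of_nat_mult[symmetric])
  ultimately show ?thesis by simp
qed

text \<open>The difference is the probability that the maximum of \<open>n\<close> independent copies equals a given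
  value, where \<open>u\<close> and \<open>v\<close> are the tails right above and at that value.\<close>

lemma power_diff_lower_bound:
  fixes u v x :: real
  assumes "0 \<le> u" "2 * u \<le> v" "v \<le> 1" "real n * u \<le> 1" "0 \<le> x" "x \<le> 1" "x \<le> 4 * real n * v"
  shows "exp (-2) / 9 * x \<le> (1 - u) ^ n - (1 - v) ^ n"
proof -
  define w where "w = v - u"
  have w: "0 \<le> w" "w \<le> 1" "v \<le> 2 * w" using assms by (auto simp: w_def)
  \<comment> \<open>This splits the difference of powers into a factor bounded below by
    \<open>exp (-2)\<close> and the factor \<open>1 - (1 - w) ^ n\<close>.\<close>
  have "1 - v \<le> (1 - u) * (1 - w)"
    using assms mult_nonneg_nonneg[of u w] w by (simp add: w_def algebra_simps)
  then have "(1 - v) ^ n \<le> ((1 - u) * (1 - w)) ^ n"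
    using assms by (intro power_mono) auto
  then have "(1 - v) ^ n \<le> (1 - u) ^ n * (1 - w) ^ n" by (simp only: power_mult_distrib)
  then have 1: "(1 - u) ^ n * (1 - (1 - w) ^ n) \<le> (1 - u) ^ n - (1 - v) ^ n"
    by (simp add: right_diff_distrib)
  have nw: "0 \<le> real n * w" using w by simp
  have "1 - w \<le> exp (- w)" using exp_ge_add_one_self[of "- w"] by simp
  then have "(1 - w) ^ n \<le> exp (- w) ^ n" using w by (intro power_mono) auto
  also have "\<dots> = inverse (exp (real n * w))"
    by (simp add: exp_of_nat_mult[symmetric] exp_minus[symmetric])
  also have "\<dots> \<le> inverse (1 + real n * w)"
    using nw exp_ge_add_one_self[of "real n * w"] by (intro le_imp_inverse_le) auto
  finally have "1 - inverse (1 + real n * w) \<le> 1 - (1 - w) ^ n" by simp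
  \<comment> \<open>The constant 9 is 8 + 1: \<open>v \<le> 2 * w\<close> gives
    \<open>x \<le> 8 * n * w\<close>, and \<open>x \<le> 1\<close> gives
    \<open>x * n * w \<le> n * w\<close>.\<close>
  moreover have "x / 9 \<le> 1 - inverse (1 + real n * w)"
  proof -
    have "real n * v \<le> real n * (2 * w)" using w by (intro mult_left_mono) auto
    then have "x \<le> 8 * (real n * w)" using assms by simp
    moreover have "x * (real n * w) \<le> real n * w"
      using mult_right_mono[OF assms(6) nw] by simp
    ultimately have "x * (1 + real n * w) \<le> 9 * (real n * w)" by (simp add: algebra_simps)
    then show ?thesis using nw by (simp add: field_simps)
  qed
  ultimately have 2: "x / 9 \<le> 1 - (1 - w) ^ n" by simp
  have "exp (-2) / 9 * x = exp (-2) * (x / 9)" by simp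
  also have "\<dots> \<le> (1 - u) ^ n * (1 - (1 - w) ^ n)"
    using assms 2 by (intro mult_mono exp_le_one_minus_power) auto
  also note 1
  finally show ?thesis .
qed

subsection \<open>The tail and the levels\<close>

definition entry_time :: "(nat \<Rightarrow> real) \<Rightarrow> nat \<Rightarrow> nat" where
  "entry_time p k = nat \<lceil>1 / tail_prob p k\<rceil>"

locale positive_pmf =
  fixes p :: "nat \<Rightarrow> real"
  assumes p_pos: "\<And>i. p i > 0"
    and p_sums: "p sums 1"
begin

abbreviation "T \<equiv> tail_prob p"
abbreviation "N \<equiv> entry_time p"

lemma tail_eq: "T n = 1 - (\<Sum>i<n. p i)"
proof -
  have "(\<Sum>i. p (i + n)) = (\<Sum>i. p i) - (\<Sum>i<n. p i)"
    by (rule suminf_minus_initial_segment) (use p_sums in \<open>auto simp: sums_iff\<close>)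
  then show ?thesis using p_sums by (simp add: tail_prob_def sums_iff add.commute)
qed

lemma tail_Suc: "T (Suc n) = T n - p n"
  by (simp add: tail_eq)

lemma tail_0: "T 0 = 1"
  by (simp add: tail_eq)

lemma tail_tendsto_0: "T \<longlonglongrightarrow> 0"
proof -
  have "(\<lambda>n. 1 - (\<Sum>i<n. p i)) \<longlonglongrightarrow> 1 - 1"
    using p_sums by (intro tendsto_intros) (simp add: sums_def)
  then show ?thesis by (simp add: tail_eq[abs_def])
qed

lemma decseq_tail: "decseq T"
  using p_pos by (intro decseq_SucI) (simp add: tail_Suc less_imp_le)

lemma tail_antimono: "m \<le> n \<Longrightarrow> T n \<le> T m"
  using decseq_tail by (rule decseqD)

lemma tail_pos: "T n > 0"
proof -
  have "0 \<le> T (Suc n)" by (rule decseq_ge[OF decseq_tail tail_tendsto_0])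
  then show ?thesis using p_pos[of n] by (simp add: tail_Suc)
qed

lemma tail_le_1: "T n \<le> 1"
  using tail_antimono[of 0 n] by (simp add: tail_0)

lemma tail_hazard: "T (Suc n) = T n * exp (- hazard p (Suc n))"
  using tail_pos[of n] tail_pos[of "Suc n"]
  by (simp add: hazard_def cum_hazard_def exp_diff)

lemma entry_time_le_iff: "N k \<le> n \<longleftrightarrow> 1 / T k \<le> real n"
  unfolding entry_time_def by linarith

lemma entry_time_mono: "i \<le> j \<Longrightarrow> N i \<le> N j"
  unfolding entry_time_def
  using tail_antimono[of i j] tail_pos by (intro nat_mono ceiling_mono divide_left_mono) auto

lemma entry_time_pos: "1 \<le> N k"
  using entry_time_le_iff[of k 0] tail_pos[of k] by (cases "N k") auto

text \<open>The condition \<open>T k \<ge> 1 / n\<close> amounts to \<open>N k \<le> n\<close>, so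
  the level is the last \<open>k\<close> whose entry time has passed. For \<open>n = 0\<close> the
  convention \<open>1 / 0 = 0\<close> would admit every \<open>k\<close>.\<close>

lemma max_level_eq_iff:
  assumes "n \<ge> 1"
  shows "max_level p n = k \<longleftrightarrow> n \<in> {N k..<N (Suc k)}"
proof -
  let ?S = "{k. tail_prob p k \<ge> 1 / real n}"
  have S: "?S = {k. N k \<le> n}"
    unfolding entry_time_le_iff using assms tail_pos by (auto simp: field_simps)
  \<comment> \<open>Finiteness of the set is what gives \<open>Max\<close> its meaning.\<close>
  have "eventually (\<lambda>k. T k < 1 / real n) sequentially"
    using tail_tendsto_0 assms by (intro order_tendstoD) auto
  then have fin: "finite ?S"
    by (simp add: eventually_sequentially finite_nat_set_iff_bounded not_le[symmetric]) (meson not_le)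
  have ne: "?S \<noteq> {}" using assms by (auto intro!: exI[of _ 0] simp: tail_0)
  have mem: "N (max_level p n) \<le> n" using Max_in[OF fin ne] unfolding max_level_def S by simp
  have ge: "k \<le> max_level p n" if "N k \<le> n" for k
    using Max_ge[OF fin] that unfolding max_level_def S by simp
  show ?thesis
  proof
    assume "max_level p n = k"
    then show "n \<in> {N k..<N (Suc k)}" using mem ge[of "Suc k"] by fastforce
  next
    assume n: "n \<in> {N k..<N (Suc k)}"
    then have "k \<le> max_level p n" by (intro ge) auto
    moreover have "\<not> Suc k \<le> max_level p n"
      using n mem entry_time_mono[of "Suc k" "max_level p n"] by fastforce
    ultimately show "max_level p n = k" by simp
  qed
qed

text \<open>Fewer than \<open>1 / T k\<close> variables precede time \<open>N k\<close>, which
  absorbs the rounding of the ceiling in later union bounds.\<close>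

lemma entry_time_pred_less: "real (N k - 1) < 1 / T k"
  using entry_time_le_iff[of k "N k - 1"] entry_time_pos[of k] by auto

end

section \<open>Tails whose hazard increases to infinity\<close>

locale rapid_tail = positive_pmf +
  assumes mono: "mono_on {1..} (hazard p)"
    and lim: "filterlim (hazard p) at_top sequentially"
begin

lemma hazard_mono: "1 \<le> m \<Longrightarrow> m \<le> n \<Longrightarrow> hazard p m \<le> hazard p n"
  using mono by (auto simp: mono_on_def)

lemma tail_ratio_tendsto_0: "(\<lambda>k. T (Suc k) / T k) \<longlonglongrightarrow> 0"
proof -
  have "filterlim (\<lambda>k. hazard p (Suc k)) at_top sequentially"
    using lim by (simp add: filterlim_sequentially_Suc)
  then have "((\<lambda>k. exp (- hazard p (Suc k))) \<longlongrightarrow> 0) sequentially"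
    by (intro filterlim_compose[OF exp_at_bot]) (simp add: filterlim_uminus_at_top)
  moreover have "T (Suc k) / T k = exp (- hazard p (Suc k))" for k
    using tail_pos[of k] by (simp add: tail_hazard)
  ultimately show ?thesis by simp
qed

text \<open>The quotient of the two tails is the exponential of minus a sum of \<open>j\<close>
  consecutive hazards, each at most the last one by monotonicity.\<close>

lemma tail_add_ge: "T (Suc k) * exp (- real j * hazard p (Suc k + j)) \<le> T (Suc k + j)"
proof (induction j)
  case (Suc j)
  have h: "hazard p (Suc k + j) \<le> hazard p (Suc k + Suc j)" by (rule hazard_mono) auto
  have "exp (- real (Suc j) * hazard p (Suc k + Suc j)) =
      exp (- real j * hazard p (Suc k + Suc j)) * exp (- hazard p (Suc k + Suc j))"
    by (simp add: exp_add[symmetric] algebra_simps)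
  moreover have "T (Suc k) * exp (- real j * hazard p (Suc k + Suc j)) \<le>
      T (Suc k) * exp (- real j * hazard p (Suc k + j))"
    using h tail_pos[of "Suc k"] by (auto intro!: mult_left_mono)
  ultimately have "T (Suc k) * exp (- real (Suc j) * hazard p (Suc k + Suc j)) \<le>
      T (Suc k + j) * exp (- hazard p (Suc k + Suc j))"
    using Suc mult_right_mono by fastforce
  also have "\<dots> = T (Suc k + Suc j)" using tail_hazard[of "Suc k + j"] by simp
  finally show ?case .
qed simp

text \<open>Here the same \<open>j\<close> hazards are bounded below by the first one. The two
  bounds differ by an index shift only, which leaves convergence of the series unchanged.\<close>

lemma tail_add_le: "T (Suc k + j) \<le> T (Suc k) * exp (- real j * hazard p (Suc (Suc k)))"
proof (induction j)
  case (Suc j)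
  have h: "hazard p (Suc (Suc k)) \<le> hazard p (Suc k + Suc j)" by (rule hazard_mono) auto
  have "T (Suc k + Suc j) = T (Suc k + j) * exp (- hazard p (Suc k + Suc j))"
    using tail_hazard[of "Suc k + j"] by simp
  also have "\<dots> \<le> (T (Suc k) * exp (- real j * hazard p (Suc (Suc k)))) * exp (- hazard p (Suc (Suc k)))"
    using h Suc tail_pos[of "Suc k"] by (intro mult_mono) auto
  also have "\<dots> = T (Suc k) * exp (- real (Suc j) * hazard p (Suc (Suc k)))"
    by (simp add: exp_add[symmetric] algebra_simps)
  finally show ?case .
qed simp

text \<open>Eventually both \<open>1 / T k\<close> and the rounding error 1 are at most a quarter of
  \<open>1 / T (Suc k)\<close>, so the block fills at least half of that length.\<close>

lemma block_length_bounds: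
  "eventually (\<lambda>k. 1 / (2 * T (Suc k)) \<le> real (N (Suc k) - N k)) sequentially"
proof -
  have "eventually (\<lambda>k. T (Suc k) / T k < 1/4) sequentially"
    using tail_ratio_tendsto_0 by (intro order_tendstoD) auto
  moreover have "eventually (\<lambda>k. T k < 1/4) sequentially"
    using tail_tendsto_0 by (intro order_tendstoD) auto
  ultimately show ?thesis
  proof eventually_elim
    case (elim k)
    have pos: "T k > 0" "T (Suc k) > 0" by (rule tail_pos)+
    have le: "T (Suc k) \<le> T k" by (rule tail_antimono) simp
    have "1 / T (Suc k) \<le> real (N (Suc k))" using entry_time_le_iff by blast
    moreover have "real (N k) \<le> 1 / T k + 1"
      using entry_time_pred_less[of k] entry_time_pos[of k] by (simp add: of_nat_diff)
    moreover have "1 / T k \<le> (1/4) * (1 / T (Suc k))"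
      using elim pos by (simp add: field_simps)
    moreover have "1 \<le> (1/4) * (1 / T (Suc k))"
      using elim pos le by (simp add: field_simps)
    moreover have "1 / (2 * T (Suc k)) = (1/2) * (1 / T (Suc k))" by simp
    moreover have "N k \<le> N (Suc k)" by (rule entry_time_mono) simp
    ultimately show ?case by (simp add: of_nat_diff)
  qed
qed

text \<open>Because \<open>N k \<ge> 1\<close>, the length is at most
  \<open>N (Suc k) - 1\<close>.\<close>

lemma block_length_le: "real (N (Suc k) - N k) \<le> 1 / T (Suc k)"
  using entry_time_pred_less[of "Suc k"] entry_time_pos[of k] entry_time_pos[of "Suc k"]
  by (smt (verit) diff_le_mono2 of_nat_mono)

end

subsection \<open>The running maximum\<close>

locale iid_rapid_tail = prob_space M + rapid_tail p for M :: "'a measure" and p +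
  fixes X :: "nat \<Rightarrow> 'a \<Rightarrow> nat"
  assumes indep: "indep_vars (\<lambda>_. count_space UNIV) X {1..}"
    and dist: "\<And>n i. n \<ge> 1 \<Longrightarrow> prob {\<omega> \<in> space M. X n \<omega> = i} = p i"
begin

lemma X_event: "i \<ge> 1 \<Longrightarrow> {\<omega> \<in> space M. P (X i \<omega>)} \<in> events"
  using restrict_event[OF indep, of "{i}" "\<lambda>f. P (f i)"] by simp

lemma prob_less: "i \<ge> 1 \<Longrightarrow> prob {\<omega> \<in> space M. X i \<omega> < m} = 1 - T m"
proof (induction m)
  case (Suc m)
  have "{\<omega> \<in> space M. X i \<omega> < Suc m} = {\<omega> \<in> space M. X i \<omega> < m} \<union> {\<omega> \<in> space M. X i \<omega> = m}"
    by auto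
  then have "prob {\<omega> \<in> space M. X i \<omega> < Suc m} =
      prob {\<omega> \<in> space M. X i \<omega> < m} + prob {\<omega> \<in> space M. X i \<omega> = m}"
    using Suc.prems by (simp only:) (intro finite_measure_Union X_event, auto)
  then show ?case using Suc by (simp add: dist tail_Suc)
qed (simp add: tail_0)

lemma prob_ge: "i \<ge> 1 \<Longrightarrow> prob {\<omega> \<in> space M. m \<le> X i \<omega>} = T m"
  using prob_neg[OF X_event, of i "\<lambda>x. x < m"] by (simp add: prob_less not_less)

lemma prob_all_less:
  assumes "finite J" "J \<subseteq> {1..}"
  shows "prob {\<omega> \<in> space M. \<forall>i\<in>J. X i \<omega> < m} = (1 - T m) ^ card J"
\<comment> \<open>The product rule for independent variables needs a nonempty index set.\<close>
proof (cases "J = {}")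
  case False
  have "{\<omega> \<in> space M. \<forall>i\<in>J. X i \<omega> < m} = (\<Inter>i\<in>J. X i -` {..<m} \<inter> space M)"
    using False by auto
  then have "prob {\<omega> \<in> space M. \<forall>i\<in>J. X i \<omega> < m} = (\<Prod>i\<in>J. prob (X i -` {..<m} \<inter> space M))"
    using indep_varsD[OF indep False assms] by simp
  also have "\<dots> = (\<Prod>i\<in>J. 1 - T m)"
  proof (intro prod.cong refl)
    fix i assume "i \<in> J"
    then have "i \<ge> 1" using assms by auto
    moreover have "X i -` {..<m} \<inter> space M = {\<omega> \<in> space M. X i \<omega> < m}" by auto
    ultimately show "prob (X i -` {..<m} \<inter> space M) = 1 - T m" by (simp add: prob_less)
  qed
  finally show ?thesis by simp
qed (simp add: prob_space)

lemma ex_ge_event: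
  assumes "finite J" "J \<subseteq> {1..}"
  shows "{\<omega> \<in> space M. \<exists>i\<in>J. m \<le> X i \<omega>} \<in> events"
  using restrict_event[OF indep assms, of "\<lambda>f. \<exists>i\<in>J. m \<le> f i"] by (simp cong: bex_cong)

lemma prob_ex_ge:
  assumes "finite J" "J \<subseteq> {1..}"
  shows "prob {\<omega> \<in> space M. \<exists>i\<in>J. m \<le> X i \<omega>} \<le> real (card J) * T m"
proof -
  have "{\<omega> \<in> space M. \<exists>i\<in>J. m \<le> X i \<omega>} = (\<Union>i\<in>J. {\<omega> \<in> space M. m \<le> X i \<omega>})" by auto
  also have "prob \<dots> \<le> (\<Sum>i\<in>J. prob {\<omega> \<in> space M. m \<le> X i \<omega>})"
    using assms by (intro finite_measure_subadditive_finite) (auto intro!: X_event)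
  also have "\<dots> = (\<Sum>i\<in>J. T m)" using assms by (intro sum.cong refl prob_ge) auto
  finally show ?thesis by simp
qed

lemma ivl_subset_Ici: "{1..<n} \<subseteq> {1..}" for n :: nat
  by auto

text \<open>A union bound over fewer than \<open>1 / T k\<close> variables. It serves both the
  convergent case and the bound on early values.\<close>

lemma prob_ex_ge_before_entry:
  "prob {\<omega> \<in> space M. \<exists>i\<in>{1..<N k}. m \<le> X i \<omega>} \<le> T m / T k"
proof -
  have "prob {\<omega> \<in> space M. \<exists>i\<in>{1..<N k}. m \<le> X i \<omega>} \<le> real (N k - 1) * T m"
    using prob_ex_ge[of "{1..<N k}" m, OF finite_atLeastLessThan ivl_subset_Ici] by simp
  also have "\<dots> \<le> 1 / T k * T m"
    using entry_time_pred_less[of k] tail_pos[of m] by (intro mult_right_mono) auto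
  finally show ?thesis by simp
qed

lemma running_max_event: "{\<omega> \<in> space M. running_max X n \<omega> = c} \<in> events"
  using restrict_event[OF indep, of "{1..n}" "\<lambda>f. Max (f ` {1..n}) = c"]
  by (auto simp: running_max_def cong: image_cong_simp)

lemma infinitely_often_event: "{\<omega> \<in> space M. \<exists>\<^sub>\<infinity>n. running_max X n \<omega> = max_level p n + l} \<in> events"
  unfolding INFM_nat using running_max_event by measurable

section \<open>The convergent case\<close>

lemma finitely_often:
  assumes "l > 1" and sm: "summable (\<lambda>k. exp (- (real l - 1) * hazard p (Suc k)))"
  shows "prob {\<omega> \<in> space M. \<exists>\<^sub>\<infinity>n. running_max X n \<omega> = max_level p n + l} = 0"
proof -
  \<comment> \<open>This contains the event that the running maximum equals \<open>k + l\<close> at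
    some time of the \<open>k\<close>-th block.\<close>
  define E where "E k = {\<omega> \<in> space M. \<exists>i\<in>{1..<N (Suc k)}. k + l \<le> X i \<omega>}" for k
  have E: "E k \<in> events" for k unfolding E_def by (rule ex_ge_event) auto
  have le: "prob (E k) \<le> exp (- (real l - 1) * hazard p (Suc (k + 1)))" for k
  proof -
    have "prob (E k) \<le> T (k + l) / T (Suc k)"
      unfolding E_def by (rule prob_ex_ge_before_entry)
    also have "\<dots> \<le> exp (- (real l - 1) * hazard p (Suc (k + 1)))"
      using tail_add_le[of k "l - 1"] \<open>l > 1\<close> tail_pos[of "Suc k"]
      by (simp add: divide_le_eq of_nat_diff mult.commute)
    finally show ?thesis .
  qed
  have "summable (\<lambda>k. exp (- (real l - 1) * hazard p (Suc (k + 1))))"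
    using summable_ignore_initial_segment[OF sm, of 1] .
  then have "summable (\<lambda>k. prob (E k))"
    by (rule summable_comparison_test'[where N = 0]) (use le in simp)
  then have "AE \<omega> in M. eventually (\<lambda>k. \<omega> \<in> space M - E k) sequentially"
    using E by (intro borel_cantelli_AE1) (auto simp: emeasure_eq_measure)
  then have "AE \<omega> in M. \<not> (\<exists>\<^sub>\<infinity>n. running_max X n \<omega> = max_level p n + l)"
  proof eventually_elim
    case (elim \<omega>)
    then obtain K where K: "\<And>k. k \<ge> K \<Longrightarrow> \<omega> \<in> space M - E k"
      by (auto simp: eventually_sequentially)
    \<comment> \<open>Beyond \<open>N K\<close> the level is at least \<open>K\<close>, where no
      \<open>E k\<close> occurs any more.\<close>
    have "running_max X n \<omega> \<noteq> max_level p n + l" if n: "n > N K" for n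
    proof
      assume eq: "running_max X n \<omega> = max_level p n + l"
      define k where "k = max_level p n"
      have n1: "n \<ge> 1" using n by simp
      then have nk: "n \<in> {N k..<N (Suc k)}" using max_level_eq_iff[of n k] by (simp add: k_def)
      have "K \<le> k"
      proof (rule ccontr)
        assume "\<not> K \<le> k"
        then have "N (Suc k) \<le> N K" by (intro entry_time_mono) auto
        then show False using nk n by simp
      qed
      have "running_max X n \<omega> \<in> (\<lambda>i. X i \<omega>) ` {1..n}"
        unfolding running_max_def using n1 by (intro Max_in) auto
      then obtain i where "i \<in> {1..n}" "X i \<omega> = k + l" using eq by (auto simp: k_def)
      then have "i \<in> {1..<N (Suc k)}" "k + l \<le> X i \<omega>" using nk by auto
      then show False using K[OF \<open>K \<le> k\<close>] unfolding E_def by blast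
    qed
    then show ?case unfolding INFM_nat by blast
  qed
  then show ?thesis using infinitely_often_event by (simp add: prob_eq_0)
qed

section \<open>Block maxima and the variables before a block\<close>

definition block_max_is :: "nat \<Rightarrow> nat \<Rightarrow> (nat \<Rightarrow> nat) \<Rightarrow> bool" where
  "block_max_is l k f \<longleftrightarrow>
    (\<forall>i\<in>{N k..<N (Suc k)}. f i < Suc (k + l)) \<and> \<not> (\<forall>i\<in>{N k..<N (Suc k)}. f i < k + l)"

definition hit :: "nat \<Rightarrow> nat \<Rightarrow> 'a set" where
  "hit l k = {\<omega> \<in> space M. block_max_is l k (\<lambda>i. X i \<omega>)}"

definition calm :: "nat \<Rightarrow> nat \<Rightarrow> 'a set" where
  "calm l k = {\<omega> \<in> space M. \<forall>i\<in>{1..<N k}. X i \<omega> < Suc (k + l)}"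

text \<open>The predicate inspects only the \<open>k\<close>-th block. Being a predicate on
  families, it can be moved to the restricted families demanded by the independence lemmas.\<close>

lemma block_max_is_restrict:
  assumes "m \<le> k" "k < K"
  shows "block_max_is l k (restrict f {N m..<N K}) = block_max_is l k f"
proof -
  have "N m \<le> N k" "N (Suc k) \<le> N K" using assms by (auto intro!: entry_time_mono)
  then have "restrict f {N m..<N K} i = f i" if "i \<in> {N k..<N (Suc k)}" for i
    using that by auto
  then show ?thesis unfolding block_max_is_def by (metis (no_types, lifting))
qed

lemma range_subset: "{N m..<N K} \<subseteq> {1..}"
  using entry_time_pos[of m] by auto

lemma hit_event: "hit l k \<in> events"
  using restrict_event[OF indep _ range_subset, of k "Suc k" "block_max_is l k"]
  by (simp add: hit_def block_max_is_restrict)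

lemma calm_event: "calm l k \<in> events"
  using restrict_event[OF indep, of "{1..<N k}" "\<lambda>f. \<forall>i\<in>{1..<N k}. f i < Suc (k + l)"]
  by (simp add: calm_def ivl_subset_Ici ball_restrict_less del: restrict_apply One_nat_def)

lemma running_max_eq_max_level:
  assumes "\<omega> \<in> calm l k \<inter> hit l k"
  shows "\<exists>n\<ge>N k. running_max X n \<omega> = max_level p n + l"
proof (intro exI conjI)
  \<comment> \<open>The last time of the block, when the whole block has been observed; a hit makes
    the block nonempty.\<close>
  define n where "n = N (Suc k) - 1"
  obtain i where i: "i \<in> {N k..<N (Suc k)}" "k + l \<le> X i \<omega>"
    using assms by (auto simp: hit_def block_max_is_def not_less)
  then have n: "n \<in> {N k..<N (Suc k)}" "i \<in> {1..n}" "n \<ge> 1"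
    using entry_time_pos[of k] by (auto simp: n_def)
  show "N k \<le> N (Suc k) - 1" using n by (simp add: n_def)
  have le: "X j \<omega> \<le> k + l" if "j \<in> {1..n}" for j
    using assms that n(1) unfolding hit_def calm_def block_max_is_def
    by (cases "j < N k") (auto simp: less_Suc_eq_le)
  have "running_max X n \<omega> = k + l"
    unfolding running_max_def
  proof (rule Max_eqI)
    show "k + l \<in> (\<lambda>i. X i \<omega>) ` {1..n}" using le[OF n(2)] i n(2) by (auto intro!: image_eqI[of _ _ i])
  qed (use le in auto)
  moreover have "max_level p n = k" using n max_level_eq_iff by blast
  ultimately show "running_max X (N (Suc k) - 1) \<omega> = max_level p (N (Suc k) - 1) + l"
    by (simp add: n_def)
qed

text \<open>By the union bound the complement has probability at most
  \<open>T (Suc k) / T k\<close>, which vanishes as the hazard diverges.\<close>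

lemma prob_calm_tendsto_1: "(\<lambda>k. prob (calm l k)) \<longlonglongrightarrow> 1"
proof (rule tendsto_sandwich)
  have "1 - T (Suc k) / T k \<le> prob (calm l k)" for k
  proof -
    have "calm l k = space M - {\<omega> \<in> space M. \<exists>i\<in>{1..<N k}. Suc (k + l) \<le> X i \<omega>}"
      unfolding calm_def by (auto simp: not_le)
    then have "prob (calm l k) = 1 - prob {\<omega> \<in> space M. \<exists>i\<in>{1..<N k}. Suc (k + l) \<le> X i \<omega>}"
      using prob_compl[OF ex_ge_event[OF finite_atLeastLessThan ivl_subset_Ici]] by simp
    moreover have "T (Suc (k + l)) / T k \<le> T (Suc k) / T k"
      using tail_antimono[of "Suc k" "Suc (k + l)"] tail_pos[of k] by (intro divide_right_mono) auto
    ultimately show ?thesis using prob_ex_ge_before_entry[of k "Suc (k + l)"] by simp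
  qed
  then show "eventually (\<lambda>k. 1 - T (Suc k) / T k \<le> prob (calm l k)) sequentially" by simp
  show "eventually (\<lambda>k. prob (calm l k) \<le> 1) sequentially" by simp
  show "(\<lambda>k. 1 - T (Suc k) / T k) \<longlonglongrightarrow> 1"
    using tendsto_diff[OF tendsto_const tail_ratio_tendsto_0, of 1] by simp
qed simp

lemma prob_hit:
  "prob (hit l k) = (1 - T (Suc (k + l))) ^ (N (Suc k) - N k) - (1 - T (k + l)) ^ (N (Suc k) - N k)"
proof -
  let ?J = "{N k..<N (Suc k)}" and ?A = "\<lambda>m. {\<omega> \<in> space M. \<forall>i\<in>{N k..<N (Suc k)}. X i \<omega> < m}"
  have ev: "?A m \<in> events" for m
    using restrict_event[OF indep _ range_subset, of k "Suc k" "\<lambda>f. \<forall>i\<in>?J. f i < m"]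
    by (simp add: ball_restrict_less del: restrict_apply)
  have "hit l k = ?A (Suc (k + l)) - ?A (k + l)" by (auto simp: hit_def block_max_is_def)
  moreover have "?A (k + l) \<subseteq> ?A (Suc (k + l))" by auto
  ultimately have "prob (hit l k) = prob (?A (Suc (k + l))) - prob (?A (k + l))"
    using ev by (simp add: finite_measure_Diff)
  then show ?thesis by (simp add: prob_all_less[OF _ range_subset])
qed

text \<open>Instance of \<open>power_diff_lower_bound\<close> with
  \<open>u = T (Suc (k + l))\<close>, \<open>v = T (k + l)\<close> and the block length as exponent.
  The minimum with 1 matters for \<open>l = 0\<close>, where the ratio is unbounded.\<close>

lemma prob_hit_lower_bound:
  "eventually (\<lambda>k. exp (-2) / 9 * min 1 (T (k + l) / T (Suc k)) \<le> prob (hit l k)) sequentially"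
proof -
  have "(\<lambda>k. T (Suc (k + l)) / T (k + l)) \<longlonglongrightarrow> 0"
    using LIMSEQ_ignore_initial_segment[OF tail_ratio_tendsto_0, of l] by simp
  then have "eventually (\<lambda>k. T (Suc (k + l)) / T (k + l) < 1/2) sequentially"
    by (rule order_tendstoD) simp
  with block_length_bounds show ?thesis
  proof eventually_elim
    case (elim k)
    let ?n = "N (Suc k) - N k"
    have pos: "T (k + l) > 0" "T (Suc k) > 0" "T (Suc (k + l)) > 0" by (rule tail_pos)+
    have "real ?n * T (Suc (k + l)) \<le> 1 / T (Suc k) * T (Suc k)"
      using pos by (intro mult_mono block_length_le tail_antimono) auto
    then have 1: "real ?n * T (Suc (k + l)) \<le> 1" using pos by simp
    have "T (k + l) / T (Suc k) \<le> 4 * (1 / (2 * T (Suc k))) * T (k + l)"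
      using pos by (simp add: field_simps)
    also have "\<dots> \<le> 4 * real ?n * T (k + l)"
      using elim pos by (intro mult_right_mono) auto
    finally have 2: "min 1 (T (k + l) / T (Suc k)) \<le> 4 * real ?n * T (k + l)" by simp
    show ?case
      unfolding prob_hit using elim pos 1 2
      by (intro power_diff_lower_bound) (auto simp: tail_le_1 field_simps)
  qed
qed

text \<open>Induction on \<open>K\<close>: the earlier blocks lie in \<open>{N m..<N K}\<close>,
  disjoint from the new block.\<close>

lemma prob_no_hit:
  assumes "m \<le> K"
  shows "prob {\<omega> \<in> space M. \<forall>k\<in>{m..<K}. \<not> block_max_is l k (\<lambda>i. X i \<omega>)} =
    (\<Prod>k\<in>{m..<K}. 1 - prob (hit l k))"
  using assms
proof (induction K rule: dec_induct)
  case (step K)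
  let ?A = "{N m..<N K}" and ?B = "{N K..<N (Suc K)}"
  have "prob {\<omega> \<in> space M. (\<forall>k\<in>{m..<K}. \<not> block_max_is l k (restrict (\<lambda>i. X i \<omega>) ?A)) \<and>
        \<not> block_max_is l K (restrict (\<lambda>i. X i \<omega>) ?B)} =
      prob {\<omega> \<in> space M. \<forall>k\<in>{m..<K}. \<not> block_max_is l k (restrict (\<lambda>i. X i \<omega>) ?A)} *
      prob {\<omega> \<in> space M. \<not> block_max_is l K (restrict (\<lambda>i. X i \<omega>) ?B)}"
    by (rule prob_conj_restrict[OF indep _ _ range_subset range_subset]) auto
  then have "prob {\<omega> \<in> space M. (\<forall>k\<in>{m..<K}. \<not> block_max_is l k (\<lambda>i. X i \<omega>)) \<and>
        \<not> block_max_is l K (\<lambda>i. X i \<omega>)} =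
      prob {\<omega> \<in> space M. \<forall>k\<in>{m..<K}. \<not> block_max_is l k (\<lambda>i. X i \<omega>)} *
      prob {\<omega> \<in> space M. \<not> block_max_is l K (\<lambda>i. X i \<omega>)}"
    by (simp add: block_max_is_restrict)
  moreover have "{\<omega> \<in> space M. \<not> block_max_is l K (\<lambda>i. X i \<omega>)} = space M - hit l K"
    by (auto simp: hit_def)
  moreover have "{\<omega> \<in> space M. \<forall>k\<in>{m..<Suc K}. \<not> block_max_is l k (\<lambda>i. X i \<omega>)} =
      {\<omega> \<in> space M. (\<forall>k\<in>{m..<K}. \<not> block_max_is l k (\<lambda>i. X i \<omega>)) \<and>
        \<not> block_max_is l K (\<lambda>i. X i \<omega>)}"
    using step by (auto simp: atLeastLessThanSuc)
  ultimately show ?case using step by (simp add: prob_compl hit_event)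
qed (simp add: prob_space)

text \<open>The first event concerns indices below \<open>N k\<close>, the second only indices from
  \<open>N k\<close> on. This is the independence required by \<open>feller_chung\<close>.\<close>

lemma calm_independent:
  assumes "k < K"
  shows "prob (calm l k \<inter> (hit l k - (\<Union>j\<in>{k<..<K}. hit l j))) =
    prob (calm l k) * prob (hit l k - (\<Union>j\<in>{k<..<K}. hit l j))"
proof -
  let ?A = "{1..<N k}" and ?B = "{N k..<N K}"
  let ?Q = "\<lambda>f. block_max_is l k f \<and> (\<forall>j\<in>{k<..<K}. \<not> block_max_is l j f)"
  have "prob {\<omega> \<in> space M. (\<forall>i\<in>?A. restrict (\<lambda>i. X i \<omega>) ?A i < Suc (k + l)) \<and>
        ?Q (restrict (\<lambda>i. X i \<omega>) ?B)} =
      prob {\<omega> \<in> space M. \<forall>i\<in>?A. restrict (\<lambda>i. X i \<omega>) ?A i < Suc (k + l)} *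
      prob {\<omega> \<in> space M. ?Q (restrict (\<lambda>i. X i \<omega>) ?B)}"
    by (rule prob_conj_restrict[OF indep _ _ _ range_subset]) auto
  then have "prob {\<omega> \<in> space M. (\<forall>i\<in>?A. X i \<omega> < Suc (k + l)) \<and> ?Q (\<lambda>i. X i \<omega>)} =
      prob (calm l k) * prob {\<omega> \<in> space M. ?Q (\<lambda>i. X i \<omega>)}"
    using assms by (simp add: block_max_is_restrict calm_def ball_restrict_less del: restrict_apply)
  moreover have "{\<omega> \<in> space M. ?Q (\<lambda>i. X i \<omega>)} = hit l k - (\<Union>j\<in>{k<..<K}. hit l j)"
    by (auto simp: hit_def)
  moreover have "{\<omega> \<in> space M. (\<forall>i\<in>?A. X i \<omega> < Suc (k + l)) \<and> ?Q (\<lambda>i. X i \<omega>)} =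
      calm l k \<inter> (hit l k - (\<Union>j\<in>{k<..<K}. hit l j))"
    by (auto simp: hit_def calm_def)
  ultimately show ?thesis by simp
qed

section \<open>The divergent case\<close>

lemma infinitely_often:
  assumes ns: "\<not> summable (\<lambda>k. min 1 (T (k + l) / T (Suc k)))"
  shows "prob {\<omega> \<in> space M. \<exists>\<^sub>\<infinity>n. running_max X n \<omega> = max_level p n + l} = 1"
proof -
  define W where "W m = {\<omega> \<in> space M. \<exists>n>m. running_max X n \<omega> = max_level p n + l}" for m
  have W: "W m \<in> events" for m unfolding W_def using running_max_event by measurable
  have "\<not> summable (\<lambda>k. prob (hit l k))"
  proof
    assume sm: "summable (\<lambda>k. prob (hit l k))"
    have "eventually (\<lambda>k. norm (exp (-2) / 9 * min 1 (T (k + l) / T (Suc k))) \<le> prob (hit l k)) sequentially"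
      using prob_hit_lower_bound
      by eventually_elim (use tail_pos in \<open>simp add: abs_mult less_imp_le\<close>)
    then have "summable (\<lambda>k. exp (-2) / 9 * min 1 (T (k + l) / T (Suc k)))"
      using sm by (rule summable_comparison_test_ev)
    then show False using ns by (simp only: summable_cmult_iff) simp
  qed
  note ns_hit = this
  have "(1 - e) * (1 - e) \<le> prob (W m)" if e: "0 < e" "e < 1" for e m
  proof -
    have "eventually (\<lambda>k. 1 - e < prob (calm l k)) sequentially"
      by (rule order_tendstoD[OF prob_calm_tendsto_1]) (use e in simp)
    moreover have "eventually (\<lambda>k. T k < 1 / real (Suc m)) sequentially"
      by (rule order_tendstoD[OF tail_tendsto_0]) simp
    ultimately have "eventually (\<lambda>k. 1 - e < prob (calm l k) \<and> T k < 1 / real (Suc m)) sequentially"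
      by (rule eventually_conj)
    then obtain k0 where k0: "\<And>k. k \<ge> k0 \<Longrightarrow> 1 - e < prob (calm l k) \<and> T k < 1 / real (Suc m)"
      unfolding eventually_sequentially by blast
    \<comment> \<open>A small tail pushes the block beyond time \<open>m\<close>, so that a calm hit
      there witnesses \<open>W m\<close>.\<close>
    have N: "m < N k" if "k \<ge> k0" for k
      using k0[OF that] tail_pos[of k] entry_time_le_iff[of k "Suc m"] entry_time_le_iff[of k m]
      by (auto simp: not_le[symmetric] field_simps)
    obtain K where K: "(\<Prod>k\<in>{k0..<K}. 1 - prob (hit l k)) < e"
      using prod_one_minus_small[OF _ _ ns_hit e(1)] by (metis measure_nonneg prob_le_1)
    \<comment> \<open>Otherwise the product would be empty, hence 1, and not below
      \<open>e\<close>.\<close>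
    have "k0 \<le> K" using K e by (cases "k0 \<le> K") auto
    have "{\<omega> \<in> space M. \<forall>k\<in>{k0..<K}. \<not> block_max_is l k (\<lambda>i. X i \<omega>)} =
        space M - (\<Union>k\<in>{k0..<K}. hit l k)"
      by (auto simp: hit_def)
    then have "prob (\<Union>k\<in>{k0..<K}. hit l k) \<ge> 1 - e"
      using prob_no_hit[OF \<open>k0 \<le> K\<close>, of l] K prob_compl[of "\<Union>k\<in>{k0..<K}. hit l k"]
      by (simp add: sets.finite_UN hit_event)
    then have "(1 - e) * (1 - e) \<le> (1 - e) * prob (\<Union>k\<in>{k0..<K}. hit l k)"
      using e by (intro mult_left_mono) auto
    also have "\<dots> \<le> prob (\<Union>k\<in>{k0..<K}. calm l k \<inter> hit l k)"
      using k0 by (intro feller_chung hit_event calm_event calm_independent) (auto intro: less_imp_le)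
    also have "\<dots> \<le> prob (W m)"
    proof (intro finite_measure_mono W subsetI)
      fix \<omega> assume "\<omega> \<in> (\<Union>k\<in>{k0..<K}. calm l k \<inter> hit l k)"
      then obtain k where k: "k \<ge> k0" "\<omega> \<in> calm l k \<inter> hit l k" by auto
      then show "\<omega> \<in> W m"
        using running_max_eq_max_level[OF k(2)] less_le_trans[OF N[OF k(1)]]
        unfolding W_def calm_def by blast
    qed
    finally show ?thesis .
  qed
  note ge = this
  have "prob (W m) = 1" for m
  proof (rule ccontr)
    assume "prob (W m) \<noteq> 1"
    then have lt: "prob (W m) < 1" using order_le_less prob_le_1[of "W m"] by blast
    \<comment> \<open>With this choice \<open>(1 - e)^2\<close> exceeds
      \<open>1 - 2 * e = prob (W m)\<close>, contradicting the lower bound.\<close>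
    define e where "e = (1 - prob (W m)) / 2"
    have e: "0 < e" "e < 1" unfolding e_def using lt measure_nonneg[of M "W m"] by argo+
    have "prob (W m) = 1 - 2 * e" by (simp add: e_def field_simps)
    moreover have "(1 - e) * (1 - e) = 1 - 2 * e + e * e" by (simp add: algebra_simps)
    moreover have "0 < e * e" using e by simp
    ultimately show False using ge[OF e, of m] by simp
  qed
  then have "AE \<omega> in M. \<omega> \<in> W m" for m using W by (simp add: prob_eq_1)
  then have "AE \<omega> in M. \<forall>m. \<omega> \<in> W m" by (simp add: AE_all_countable)
  then have "AE \<omega> in M. \<omega> \<in> {\<omega> \<in> space M. \<exists>\<^sub>\<infinity>n. running_max X n \<omega> = max_level p n + l}"
    by eventually_elim (auto simp: W_def INFM_nat)
  then show ?thesis using infinitely_often_event by (simp add: prob_eq_1)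
qed

text \<open>For \<open>l \<le> 1\<close> every term equals 1. For \<open>l > 1\<close> the terms
  eventually dominate a shift of the given exponential series.\<close>

lemma not_summable_tail_ratio:
  assumes "l > 1 \<longrightarrow> \<not> summable (\<lambda>k. exp (- (real l - 1) * hazard p (Suc k)))"
  shows "\<not> summable (\<lambda>k. min 1 (T (k + l) / T (Suc k)))"
proof (cases "l > 1")
  case False
  then have "T (Suc k) \<le> T (k + l)" for k by (intro tail_antimono) auto
  then have "min 1 (T (k + l) / T (Suc k)) = 1" for k using tail_pos[of "Suc k"] by (simp add: min_def)
  then show ?thesis by (simp add: summable_const_iff)
next
  case True
  show ?thesis
  proof
    assume sm: "summable (\<lambda>k. min 1 (T (k + l) / T (Suc k)))"
    \<comment> \<open>A nonnegative hazard keeps the exponential at most 1, as the minimum with 1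
      demands.\<close>
    have ev: "eventually (\<lambda>k. 0 \<le> hazard p (Suc (k + (l - 1)))) sequentially"
    proof -
      have "filterlim (\<lambda>k. hazard p (k + l)) at_top sequentially"
        using lim filterlim_ident
        by (intro filterlim_compose[OF lim] filterlim_add_const_nat_at_top)
      then show ?thesis using True by (simp add: filterlim_at_top)
    qed
    have "eventually (\<lambda>k. norm (exp (- (real l - 1) * hazard p (Suc (k + (l - 1))))) \<le>
        min 1 (T (k + l) / T (Suc k))) sequentially"
      using ev
    proof eventually_elim
      case (elim k)
      have "T (Suc k) * exp (- (real l - 1) * hazard p (Suc (k + (l - 1)))) \<le> T (k + l)"
        using tail_add_ge[of k "l - 1"] True by (simp add: of_nat_diff)
      then have "exp (- (real l - 1) * hazard p (Suc (k + (l - 1)))) \<le> T (k + l) / T (Suc k)"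
        using tail_pos[of "Suc k"] by (simp add: pos_le_divide_eq mult.commute)
      moreover have "- (real l - 1) * hazard p (Suc (k + (l - 1))) \<le> 0"
        using elim True by (intro mult_nonpos_nonneg) auto
      ultimately show ?case by (simp only: real_norm_def abs_exp_cancel min.bounded_iff exp_le_one_iff)
    qed
    then have "summable (\<lambda>k. exp (- (real l - 1) * hazard p (Suc (k + (l - 1)))))"
      using sm by (rule summable_comparison_test_ev)
    then have "summable (\<lambda>k. exp (- (real l - 1) * hazard p (Suc k)))"
      by (rule summable_iff_shift[THEN iffD1])
    then show False using assms True by simp
  qed
qed

end

text \<open>With \<open>Suc k\<close> the series starts at \<open>hazard p 1\<close> and avoids the
  default value at 0.\<close>

theorem theorem1:
  fixes M :: "'a measure" and X :: "nat \<Rightarrow> 'a \<Rightarrow> nat" and p :: "nat \<Rightarrow> real" and l :: nat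
  assumes "prob_space M"
    and "prob_space.indep_vars M (\<lambda>_. count_space UNIV) X {1..}"
    and "\<And>n i. n \<ge> 1 \<Longrightarrow> measure M {\<omega> \<in> space M. X n \<omega> = i} = p i"
    and "\<And>i. p i > 0"
    and "p sums 1"
    and "mono_on {1..} (hazard p) \<or> antimono_on {1..} (hazard p)"
    and "filterlim (hazard p) at_top sequentially"
  shows "(l \<in> {0, 1} \<longrightarrow>
            measure M {\<omega> \<in> space M. \<exists>\<^sub>\<infinity>n. running_max X n \<omega> = max_level p n + l} = 1) \<and>
         (l > 1 \<longrightarrow>
            (summable (\<lambda>k. exp (- (real l - 1) * hazard p (Suc k))) \<longrightarrow>
              measure M {\<omega> \<in> space M. \<exists>\<^sub>\<infinity>n. running_max X n \<omega> = max_level p n + l} = 0) \<and>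
            (\<not> summable (\<lambda>k. exp (- (real l - 1) * hazard p (Suc k))) \<longrightarrow>
              measure M {\<omega> \<in> space M. \<exists>\<^sub>\<infinity>n. running_max X n \<omega> = max_level p n + l} = 1))"
proof -
  interpret prob_space M by fact
  have "mono_on {1..} (hazard p)"
    using assms(6,7) not_antimono_on_tendsto_at_top by blast
  then interpret iid_rapid_tail M p X
    using assms by unfold_locales auto
  show ?thesis
    using infinitely_often[OF not_summable_tail_ratio, of l] finitely_often[of l] by auto
qed

end
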